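(* Let $r,s,t$ be positive integers, let $A \in M_{r,s}(\mathcal{O}_K)$ and $B \in M_{s,t}(\mathcal{O}_K)$, and set $a_i = \sigma_i(A)$ and $b_j = \sigma_j(B)$. Let $\mathcal{P}'_{r,s,t}(A,B) : M_{r,s}(K)\times M_{s,t}(K) \to M_{r,t}(K)$ be the linear map $(dA,dB) \mapsto A\cdot dB + dA \cdot B$, and let $\mathcal{L}_0 = M_{r,s}(\mathcal{O}_K)\times M_{s,t}(\mathcal{O}_K)$. Then $$\mathcal{P}'_{r,s,t}(A,B)(\mathcal{L}_0) = U_A \cdot M_{r,t}((a_i),(b_j)) \cdot V_B$$ and $$\mathrm{length}\left(\frac{M_{r,t}(\mathcal{O}_K)}{\mathcal{P}'_{r,s,t}(A,B)(\mathcal{L}_0)}\right) = \sum_{i,j} \min(a_i,b_j),$$ where the sum runs over $1 \le i \le r$ and $1 \le j \le t$, and length means length as an $\mathcal{O}_K$-module.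
   Context: $K$ is a complete discrete valuation field with valuation $\mathrm{val} : K \to \mathbb{Z}\cup\{+\infty\}$ (surjective), ring of integers $\mathcal{O}_K$ and $\pi\in K$ an element of valuation $1$. $M_{m,n}(K)$ is the space of $m\times n$ matrices over $K$. Smith decomposition: for $M\in M_{m,n}(K)$ one fixes a decomposition $M = U_M\cdot\Delta_M\cdot V_M$ with $U_M\in GL_m(\mathcal{O}_K)$ and $V_M\in GL_n(\mathcal{O}_K)$ (unimodular) and $\Delta_M \in M_{m,n}(K)$ diagonal. $\sigma_i(M)$ denotes the valuation of the $(i,i)$-th entry of $\Delta_M$ (which is $+\infty$ if that entry is $0$), ordered so that $\sigma_i(M)\le\sigma_{i+1}(M)$; by convention $\sigma_i(M)=+\infty$ if $i>\min(m,n)$. $M_{r,t}((a_i),(b_j))$ is the set of matrices $M=(M_{i,j})\in M_{r,t}(\mathcal{O}_K)$ such that $\mathrm{val}(M_{i,j})\ge\min(a_i,b_j)$ for all $(i,j)$ (where $\mathrm{val}(x) \geq +\infty$ means $x=0$). The map $\mathcal{P}'_{r,s,t}(A,B)$ is the differential at $(A,B)$ of the matrix multiplication map $(A,B)\mapsto AB$. The length is $+\infty$ if the sum is. *)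

theory Defs
  imports
    "HOL-Library.Extended"
    "HOL-Library.Extended_Nat"
    "HOL-Algebra.AbelCoset"
    "HOL-Algebra.Module"
    "Jordan_Normal_Form.Matrix"
begin

section \<open>Complete discrete valuation fields\<close>

text \<open>
  The value group with infinity is \<^typ>\<open>int extended\<close>; surjectivity onto the integers together with
  plus infinity also excludes the value \<^term>\<open>Minf\<close>.
\<close>

locale complete_discrete_valuation =
  fixes val :: "'k::field \<Rightarrow> int extended"
  assumes val_range: "range val = insert Pinf (range Fin)"
    and val_eq_Pinf: "val x = Pinf \<longleftrightarrow> x = 0"
    and val_mult: "val (x * y) = val x + val y"
    and val_add: "min (val x) (val y) \<le> val (x + y)"
    and val_complete:
      "(\<And>N::int. \<exists>n0. \<forall>m\<ge>n0. \<forall>n\<ge>n0. Fin N \<le> val (X m - X n)) \<Longrightarrow>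
       \<exists>l. \<forall>N::int. \<exists>n0. \<forall>n\<ge>n0. Fin N \<le> val (X (n::nat) - l)"

definition val_integers :: "('k::field \<Rightarrow> int extended) \<Rightarrow> 'k set" where
  "val_integers val = {x. 0 \<le> val x}"

definition val_ring :: "('k::field \<Rightarrow> int extended) \<Rightarrow> 'k ring" where
  "val_ring val = \<lparr>carrier = val_integers val, monoid.mult = (*), one = 1, zero = 0, add = (+)\<rparr>"


section \<open>Integral matrices and Smith decompositions\<close>

definition int_mats :: "('k::field \<Rightarrow> int extended) \<Rightarrow> nat \<Rightarrow> nat \<Rightarrow> 'k mat set" where
  "int_mats val m n =
     {M \<in> carrier_mat m n. \<forall>i<m. \<forall>j<n. M $$ (i, j) \<in> val_integers val}"

definition int_GL :: "('k::field \<Rightarrow> int extended) \<Rightarrow> nat \<Rightarrow> 'k mat set" where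
  "int_GL val n =
     {U \<in> int_mats val n n. \<exists>W \<in> int_mats val n n. U * W = 1\<^sub>m n \<and> W * U = 1\<^sub>m n}"

text \<open>
  Matrix indices start at 0, so \<open>diag_val val D i\<close> is \<open>\<sigma>\<^sub>i\<^sub>+\<^sub>1(M)\<close> when \<open>D\<close> is the diagonal factor of
  the decomposition chosen for \<open>M\<close>.
\<close>

definition diag_val :: "('k::field \<Rightarrow> int extended) \<Rightarrow> 'k mat \<Rightarrow> nat \<Rightarrow> int extended" where
  "diag_val val D i =
     (if i < min (dim_row D) (dim_col D) then val (D $$ (i, i)) else Pinf)"

definition smith_decomposition ::
  "('k::field \<Rightarrow> int extended) \<Rightarrow> nat \<Rightarrow> nat \<Rightarrow> 'k mat \<Rightarrow> 'k mat \<Rightarrow> 'k mat \<Rightarrow> 'k mat \<Rightarrow> bool" where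
  "smith_decomposition val m n M U D V \<longleftrightarrow>
     U \<in> int_GL val m \<and> V \<in> int_GL val n \<and>
     D \<in> carrier_mat m n \<and> diagonal_mat D \<and>
     M = U * D * V \<and>
     (\<forall>i. diag_val val D i \<le> diag_val val D (Suc i))"

definition min_mats ::
  "('k::field \<Rightarrow> int extended) \<Rightarrow> nat \<Rightarrow> nat \<Rightarrow>
     (nat \<Rightarrow> int extended) \<Rightarrow> (nat \<Rightarrow> int extended) \<Rightarrow> 'k mat set" where
  "min_mats val r t a b =
     {M \<in> int_mats val r t. \<forall>i<r. \<forall>j<t. min (a i) (b j) \<le> val (M $$ (i, j))}"

definition mult_differential :: "'k::field mat \<Rightarrow> 'k mat \<Rightarrow> 'k mat \<times> 'k mat \<Rightarrow> 'k mat" where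
  "mult_differential A B = (\<lambda>(dA, dB). A * dB + dA * B)"


section \<open>Quotient modules and length\<close>

text \<open>
  The module record extends the ring record; its fields \<open>mult\<close> and \<open>one\<close> play no role for modules.
\<close>

definition quot_module :: "('a, 'b, 'c) module_scheme \<Rightarrow> 'b set \<Rightarrow> ('a, 'b set) module" where
  "quot_module M N =
     \<lparr>carrier = a_rcosets\<^bsub>M\<^esub> N, monoid.mult = undefined, one = undefined,
      zero = N, add = set_add M,
      smult = (\<lambda>c X. \<Union>x\<in>X. N +>\<^bsub>M\<^esub> (c \<odot>\<^bsub>M\<^esub> x))\<rparr>"

text \<open>
  The length is the supremum of all \<open>n\<close> for which there is a strictly increasing chain
  \<open>C 0 \<subset> \<dots> \<subset> C n\<close> of submodules.
\<close>

definition module_length :: "('a, 'd) ring_scheme \<Rightarrow> ('a, 'b, 'c) module_scheme \<Rightarrow> enat" where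
  "module_length R M =
     (SUP n \<in> {n. \<exists>C. (\<forall>i\<le>n. submodule (C i) R M) \<and> (\<forall>i<n. C i \<subset> C (Suc i))}. enat n)"

definition int_mat_module ::
  "('k::field \<Rightarrow> int extended) \<Rightarrow> nat \<Rightarrow> nat \<Rightarrow> ('k, 'k mat) module" where
  "int_mat_module val m n = (module_mat TYPE('k) m n)\<lparr>carrier := int_mats val m n\<rparr>"

fun extended_of_enat :: "enat \<Rightarrow> int extended" where
  "extended_of_enat (enat n) = Fin (int n)"
| "extended_of_enat infinity_class.infinity = Pinf"

end

theory Submission
  imports Defs
begin

text \<open>
  Substituting \<open>dA = U\<^sub>A P U\<^sub>B\<inverse>\<close> and \<open>dB = V\<^sub>A\<inverse> Q V\<^sub>B\<close>, which preserves integrality, reduces the image formula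
  to the diagonal case, where the \<open>(i, j)\<close> entry of \<open>\<Delta>\<^sub>A Q + P \<Delta>\<^sub>B\<close> is an arbitrary integral combination of
  the two diagonal entries. As \<open>M \<mapsto> U\<^sub>A M V\<^sub>B\<close> is an automorphism of the integral matrices, it remains to find
  the length of the quotient by a lattice given by entrywise bounds \<open>c\<^sub>i\<^sub>j\<close> on the valuation. Lowering
  the bounds one by one gives a chain of length \<open>\<Sum> c\<^sub>i\<^sub>j\<close>, and arbitrarily long ones if some bound is infinite.
  For finite bounds no chain is longer: as in Gaussian elimination, a submodule containing the lattice
  is strictly smaller than another one only if it has fewer leading positions, a leading position being
  a matrix position together with a valuation below \<open>c\<^sub>i\<^sub>j\<close> that occurs there for a leading entry.
\<close>

section \<open>Length of quotient modules\<close>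

text \<open>Negation is multiplication by minus one, so the subgroup condition reduces to closure
  under addition and scalars. All later submodule checks go through this form.\<close>

lemma (in module) submodule_iff:
  "submodule H R M \<longleftrightarrow> H \<subseteq> carrier M \<and> \<zero>\<^bsub>M\<^esub> \<in> H \<and> (\<forall>x\<in>H. \<forall>y\<in>H. x \<oplus>\<^bsub>M\<^esub> y \<in> H) \<and>
     (\<forall>a\<in>carrier R. \<forall>x\<in>H. a \<odot>\<^bsub>M\<^esub> x \<in> H)"
proof
  assume H: "submodule H R M"
  then interpret additive_subgroup H M
    by (intro additive_subgroup.intro) (simp add: submodule_def)
  show "H \<subseteq> carrier M \<and> \<zero>\<^bsub>M\<^esub> \<in> H \<and> (\<forall>x\<in>H. \<forall>y\<in>H. x \<oplus>\<^bsub>M\<^esub> y \<in> H) \<and>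
     (\<forall>a\<in>carrier R. \<forall>x\<in>H. a \<odot>\<^bsub>M\<^esub> x \<in> H)"
    using a_subset submodule.smult_closed[OF H] by auto
next
  assume *: "H \<subseteq> carrier M \<and> \<zero>\<^bsub>M\<^esub> \<in> H \<and> (\<forall>x\<in>H. \<forall>y\<in>H. x \<oplus>\<^bsub>M\<^esub> y \<in> H) \<and>
     (\<forall>a\<in>carrier R. \<forall>x\<in>H. a \<odot>\<^bsub>M\<^esub> x \<in> H)"
  have "\<ominus>\<^bsub>M\<^esub> x \<in> H" if "x \<in> H" for x
  proof -
    have "\<ominus>\<^bsub>M\<^esub> x = (\<ominus> \<one>) \<odot>\<^bsub>M\<^esub> x"
      using * that by (subst smult_l_minus) auto
    then show ?thesis using * that by simp
  qed
  then show "submodule H R M" using * by (intro submoduleI) auto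
qed

section \<open>Quotient modules and the correspondence of submodules\<close>

context module
begin

context
  fixes N
  assumes N: "submodule N R M"
begin

interpretation N: abelian_subgroup N M
  using N by (intro abelian_subgroupI3 additive_subgroup.intro M.abelian_group_axioms)
    (simp add: submodule_def)

lemma quot_module_sel:
  "carrier (quot_module M N) = a_rcosets\<^bsub>M\<^esub> N"
  "zero (quot_module M N) = N"
  "add (quot_module M N) = set_add M"
  by (simp_all add: quot_module_def)

lemma rcosets_iff: "X \<in> a_rcosets\<^bsub>M\<^esub> N \<longleftrightarrow> (\<exists>x\<in>carrier M. X = N +>\<^bsub>M\<^esub> x)"
  by (auto simp: A_RCOSETS_def')

lemma rcoset_eq_iff:
  assumes "x \<in> carrier M" "y \<in> carrier M"
  shows "N +>\<^bsub>M\<^esub> x = N +>\<^bsub>M\<^esub> y \<longleftrightarrow> x \<ominus>\<^bsub>M\<^esub> y \<in> N"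
  using N.a_rcos_module_rev N.a_rcos_module_imp assms
  by (metis M.a_repr_independence N N.a_rcos_self M.minus_eq submodule.axioms(1))

text \<open>Every representative of the coset is \<open>n \<oplus> x\<close> with \<open>n\<close>
  in \<open>N\<close>, and \<open>a\<close> times it differs from \<open>a\<close> times
  \<open>x\<close> by an element of \<open>N\<close>. Hence the union defining the scalar
  multiplication runs over copies of one and the same coset, and it is not an empty union.\<close>

lemma quot_smult:
  assumes "a \<in> carrier R" "x \<in> carrier M"
  shows "a \<odot>\<^bsub>quot_module M N\<^esub> (N +>\<^bsub>M\<^esub> x) = N +>\<^bsub>M\<^esub> (a \<odot>\<^bsub>M\<^esub> x)"
proof -
  have "N +>\<^bsub>M\<^esub> (a \<odot>\<^bsub>M\<^esub> y) = N +>\<^bsub>M\<^esub> (a \<odot>\<^bsub>M\<^esub> x)" if y: "y \<in> N +>\<^bsub>M\<^esub> x" for y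
  proof -
    obtain n where n: "n \<in> N" "y = n \<oplus>\<^bsub>M\<^esub> x" using y by (auto simp: a_r_coset_def')
    have nM: "n \<in> carrier M" using n N.a_subset by auto
    have "a \<odot>\<^bsub>M\<^esub> n \<in> N" using N n assms by (simp add: submodule_iff)
    moreover have "a \<odot>\<^bsub>M\<^esub> y \<ominus>\<^bsub>M\<^esub> a \<odot>\<^bsub>M\<^esub> x = a \<odot>\<^bsub>M\<^esub> n"
      using n nM assms by (simp add: smult_r_distr M.minus_eq M.a_assoc M.r_neg)
    ultimately show ?thesis
      using n nM assms by (subst rcoset_eq_iff) auto
  qed
  moreover have "x \<in> N +>\<^bsub>M\<^esub> x" using assms by (simp add: N.a_rcos_self)
  ultimately have "(\<Union>y \<in> N +>\<^bsub>M\<^esub> x. N +>\<^bsub>M\<^esub> (a \<odot>\<^bsub>M\<^esub> y)) = N +>\<^bsub>M\<^esub> (a \<odot>\<^bsub>M\<^esub> x)"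
    by (intro SUP_eq_const) blast+
  then show ?thesis by (simp only: quot_module_def module.simps)
qed

lemma quot_add:
  assumes "x \<in> carrier M" "y \<in> carrier M"
  shows "(N +>\<^bsub>M\<^esub> x) <+>\<^bsub>M\<^esub> (N +>\<^bsub>M\<^esub> y) = N +>\<^bsub>M\<^esub> (x \<oplus>\<^bsub>M\<^esub> y)"
  using assms by (rule N.a_rcos_sum)

text \<open>Each axiom is inherited from \<open>M\<close> through coset representatives. The result
  makes \<open>submodule_iff\<close> available for the quotient.\<close>

lemma module_quot_module: "module R (quot_module M N)"
proof (rule moduleI)
  show "cring R" by (rule R.is_cring)
  have zero: "N = N +>\<^bsub>M\<^esub> \<zero>\<^bsub>M\<^esub>" using N.a_subset by simp
  show "abelian_group (quot_module M N)"
  proof (rule abelian_groupI)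
    fix X assume "X \<in> carrier (quot_module M N)"
    then obtain x where x: "x \<in> carrier M" "X = N +>\<^bsub>M\<^esub> x" by (auto simp: quot_module_sel rcosets_iff)
    have "(N +>\<^bsub>M\<^esub> \<zero>\<^bsub>M\<^esub>) <+>\<^bsub>M\<^esub> X = X" using x quot_add[of "\<zero>\<^bsub>M\<^esub>" x] by (simp del: a_coset_add_zero)
    then show "\<zero>\<^bsub>quot_module M N\<^esub> \<oplus>\<^bsub>quot_module M N\<^esub> X = X"
      using zero by (simp add: quot_module_sel)
    show "\<exists>Y\<in>carrier (quot_module M N). Y \<oplus>\<^bsub>quot_module M N\<^esub> X = \<zero>\<^bsub>quot_module M N\<^esub>"
      using x zero by (intro bexI[of _ "N +>\<^bsub>M\<^esub> (\<ominus>\<^bsub>M\<^esub> x)"])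
        (auto simp: quot_module_sel rcosets_iff quot_add M.l_neg)
  next
    show "\<zero>\<^bsub>quot_module M N\<^esub> \<in> carrier (quot_module M N)"
      using zero by (auto simp: quot_module_sel rcosets_iff)
  next
    fix X Y assume "X \<in> carrier (quot_module M N)" "Y \<in> carrier (quot_module M N)"
    then obtain x y where "x \<in> carrier M" "X = N +>\<^bsub>M\<^esub> x" "y \<in> carrier M" "Y = N +>\<^bsub>M\<^esub> y"
      by (auto simp: quot_module_sel rcosets_iff)
    then show "X \<oplus>\<^bsub>quot_module M N\<^esub> Y \<in> carrier (quot_module M N)"
      "X \<oplus>\<^bsub>quot_module M N\<^esub> Y = Y \<oplus>\<^bsub>quot_module M N\<^esub> X"
      by (auto simp: quot_module_sel quot_add M.a_comm rcosets_iff)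
  qed (auto simp: quot_module_sel rcosets_iff quot_add M.a_assoc)
next
  fix a X assume "a \<in> carrier R" "X \<in> carrier (quot_module M N)"
  then show "a \<odot>\<^bsub>quot_module M N\<^esub> X \<in> carrier (quot_module M N)"
    by (metis quot_module_sel(1) rcosets_iff quot_smult smult_closed)
qed (auto simp: quot_module_sel rcosets_iff quot_smult quot_add smult_l_distr smult_r_distr
    smult_assoc1)

text \<open>One direction of the correspondence theorem: the union of a set of cosets is its
  preimage under the projection.\<close>

lemma submodule_Union_quot:
  assumes H: "submodule H R (quot_module M N)"
  shows "submodule (\<Union>H) R M" "N \<subseteq> \<Union>H"
proof -
  interpret Q: module R "quot_module M N" by (rule module_quot_module)
  have H': "H \<subseteq> a_rcosets\<^bsub>M\<^esub> N" "N \<in> H" "\<And>X Y. X \<in> H \<Longrightarrow> Y \<in> H \<Longrightarrow> X <+>\<^bsub>M\<^esub> Y \<in> H"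
    "\<And>a X. a \<in> carrier R \<Longrightarrow> X \<in> H \<Longrightarrow> a \<odot>\<^bsub>quot_module M N\<^esub> X \<in> H"
    using H by (auto simp: Q.submodule_iff quot_module_sel)
  show "N \<subseteq> \<Union>H" using H' by auto
  \<comment> \<open>Membership in the union is restated as membership of the coset, so that closure
    of \<open>H\<close> in the quotient transfers directly.\<close>
  have mem: "x \<in> \<Union>H \<longleftrightarrow> x \<in> carrier M \<and> N +>\<^bsub>M\<^esub> x \<in> H" for x
  proof
    assume "x \<in> \<Union>H"
    then obtain X where X: "X \<in> H" "x \<in> X" by auto
    then obtain y where y: "y \<in> carrier M" "X = N +>\<^bsub>M\<^esub> y" 
      using H'(1) rcosets_iff[of X] by auto
    have "x \<in> carrier M" using X y M.a_r_coset_subset_G[OF N.a_subset y(1)] by auto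
    moreover have "N +>\<^bsub>M\<^esub> y = N +>\<^bsub>M\<^esub> x"
      using X(2) y N.a_subgroup by (intro M.a_repr_independence) simp_all
    ultimately show "x \<in> carrier M \<and> N +>\<^bsub>M\<^esub> x \<in> H" using X y by simp
  next
    assume "x \<in> carrier M \<and> N +>\<^bsub>M\<^esub> x \<in> H"
    then show "x \<in> \<Union>H" using N.a_rcos_self[of x] by (intro UnionI) simp_all
  qed
  show "submodule (\<Union>H) R M"
    unfolding submodule_iff
  proof (intro conjI ballI)
    show "\<Union>H \<subseteq> carrier M" by (intro subsetI) (drule mem[THEN iffD1], simp)
    show "\<zero>\<^bsub>M\<^esub> \<in> \<Union>H" using H'(2) N.zero_closed by (rule UnionI)
  next
    fix x y assume "x \<in> \<Union>H" "y \<in> \<Union>H"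
    then show "x \<oplus>\<^bsub>M\<^esub> y \<in> \<Union>H"
      unfolding mem using H'(3)[of "N +>\<^bsub>M\<^esub> x" "N +>\<^bsub>M\<^esub> y"] by (simp add: quot_add)
  next
    fix a x assume "a \<in> carrier R" "x \<in> \<Union>H"
    then show "a \<odot>\<^bsub>M\<^esub> x \<in> \<Union>H"
      unfolding mem using H'(4)[of a "N +>\<^bsub>M\<^esub> x"] by (simp add: quot_smult)
  qed
qed

text \<open>The other direction of the correspondence theorem: the projection respects both
  operations, so it carries submodules to submodules.\<close>

lemma submodule_image_quot:
  assumes L: "submodule L R M" and "N \<subseteq> L"
  shows "submodule ((\<lambda>x. N +>\<^bsub>M\<^esub> x) ` L) R (quot_module M N)"
proof -
  interpret Q: module R "quot_module M N" by (rule module_quot_module)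
  have LM: "x \<in> carrier M" if "x \<in> L" for x using L that by (auto simp: submodule_iff)
  have "\<zero>\<^bsub>M\<^esub> \<in> L" using L by (simp add: submodule_iff)
  moreover have "N +>\<^bsub>M\<^esub> \<zero>\<^bsub>M\<^esub> = N" using N.a_subset by simp
  ultimately have zero: "N \<in> (\<lambda>x. N +>\<^bsub>M\<^esub> x) ` L"
    by (metis imageI)
  have add: "X <+>\<^bsub>M\<^esub> Y \<in> (\<lambda>x. N +>\<^bsub>M\<^esub> x) ` L"
    if "X \<in> (\<lambda>x. N +>\<^bsub>M\<^esub> x) ` L" "Y \<in> (\<lambda>x. N +>\<^bsub>M\<^esub> x) ` L" for X Y
  proof -
    obtain x y where xy: "x \<in> L" "X = N +>\<^bsub>M\<^esub> x" "y \<in> L" "Y = N +>\<^bsub>M\<^esub> y"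
      using \<open>X \<in> _\<close> \<open>Y \<in> _\<close> by (elim imageE) simp
    then have "x \<oplus>\<^bsub>M\<^esub> y \<in> L" using L by (simp add: submodule_iff)
    then show ?thesis using xy LM by (simp add: quot_add)
  qed
  have smult: "a \<odot>\<^bsub>quot_module M N\<^esub> X \<in> (\<lambda>x. N +>\<^bsub>M\<^esub> x) ` L"
    if "a \<in> carrier R" "X \<in> (\<lambda>x. N +>\<^bsub>M\<^esub> x) ` L" for a X
  proof -
    obtain x where x: "x \<in> L" "X = N +>\<^bsub>M\<^esub> x" using \<open>X \<in> _\<close> by (elim imageE) simp
    then have "a \<odot>\<^bsub>M\<^esub> x \<in> L" using L \<open>a \<in> _\<close> by (simp add: submodule_iff)
    then show ?thesis using x LM \<open>a \<in> _\<close> by (simp add: quot_smult)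
  qed
  have sub: "(\<lambda>x. N +>\<^bsub>M\<^esub> x) ` L \<subseteq> a_rcosets\<^bsub>M\<^esub> N"
    using LM M.a_rcosetsI[OF N.a_subset] by (intro image_subsetI) simp
  show ?thesis unfolding Q.submodule_iff quot_module_sel
    by (intro conjI ballI zero add smult sub; assumption)
qed

text \<open>If \<open>x\<close> in \<open>L'\<close> had the same coset as some \<open>y\<close> in
  \<open>L\<close>, then \<open>x \<ominus> y\<close> would lie in \<open>N\<close>, hence in
  \<open>L\<close>, and so would \<open>x\<close>. A coset of an element outside \<open>L\<close> is
  therefore new.\<close>

lemma submodule_image_quot_strict:
  assumes L: "submodule L R M" "submodule L' R M" and "N \<subseteq> L" "L \<subset> L'"
  shows "(\<lambda>x. N +>\<^bsub>M\<^esub> x) ` L \<subset> (\<lambda>x. N +>\<^bsub>M\<^esub> x) ` L'"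
proof -
  obtain x where x: "x \<in> L'" "x \<notin> L" using assms by auto
  have "N +>\<^bsub>M\<^esub> x \<noteq> N +>\<^bsub>M\<^esub> y" if y: "y \<in> L" for y
  proof
    assume eq: "N +>\<^bsub>M\<^esub> x = N +>\<^bsub>M\<^esub> y"
    have xy: "x \<in> carrier M" "y \<in> carrier M" using x y L by (auto simp: submodule_iff)
    then have "x \<ominus>\<^bsub>M\<^esub> y \<in> L" using eq rcoset_eq_iff assms by auto
    then have "(x \<ominus>\<^bsub>M\<^esub> y) \<oplus>\<^bsub>M\<^esub> y \<in> L" using L y by (simp add: submodule_iff)
    then show False using x xy by (simp add: M.minus_eq M.a_assoc M.l_neg)
  qed
  then show ?thesis using x assms by blast
qed

end

end

text \<open>Chains in the quotient by \<open>N\<close> are traded for chains in \<open>M\<close>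
  above \<open>N\<close>, which avoids cosets from here on. As in the definition of length,
  \<open>n\<close> counts the inclusions, so there are \<open>n + 1\<close> members.\<close>

definition submodule_chain ::
  "('a, 'd) ring_scheme \<Rightarrow> ('a, 'b, 'c) module_scheme \<Rightarrow> 'b set \<Rightarrow> nat \<Rightarrow> (nat \<Rightarrow> 'b set) \<Rightarrow> bool" where
  "submodule_chain R M N n C \<longleftrightarrow>
     (\<forall>i\<le>n. submodule (C i) R M \<and> N \<subseteq> C i) \<and> (\<forall>i<n. C i \<subset> C (Suc i))"

lemma submodule_chain_mono:
  "submodule_chain R M N n C \<Longrightarrow> N' \<subseteq> N \<Longrightarrow> submodule_chain R M N' n C"
  unfolding submodule_chain_def by blast

context module
begin

text \<open>Unions of cosets and images under the projection turn chains on either side into chains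
  on the other without changing the number of steps, so both suprema run over the same set.\<close>

lemma module_length_quot:
  assumes N: "submodule N R M"
  shows "module_length R (quot_module M N) = (SUP n \<in> {n. \<exists>C. submodule_chain R M N n C}. enat n)"
proof -
  have "(\<exists>C. (\<forall>i\<le>n. submodule (C i) R (quot_module M N)) \<and> (\<forall>i<n. C i \<subset> C (Suc i)))
     \<longleftrightarrow> (\<exists>C. submodule_chain R M N n C)" for n
  proof
    assume "\<exists>C. (\<forall>i\<le>n. submodule (C i) R (quot_module M N)) \<and> (\<forall>i<n. C i \<subset> C (Suc i))"
    then obtain C where C: "\<And>i. i \<le> n \<Longrightarrow> submodule (C i) R (quot_module M N)"
      "\<And>i. i < n \<Longrightarrow> C i \<subset> C (Suc i)" by auto
    interpret Q: module R "quot_module M N" by (rule module_quot_module[OF N])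
    have "\<Union>(C i) \<subset> \<Union>(C (Suc i))" if i: "i < n" for i
    proof -
      obtain X where X: "X \<in> C (Suc i)" "X \<notin> C i" using C(2)[OF i] by auto
      have sub: "C i \<subseteq> a_rcosets\<^bsub>M\<^esub> N" "C (Suc i) \<subseteq> a_rcosets\<^bsub>M\<^esub> N"
        using C(1)[of i] C(1)[of "Suc i"] i by (auto simp: Q.submodule_iff quot_module_sel[OF N])
      \<comment> \<open>Distinct cosets are disjoint, so a coset missing from \<open>C i\<close>
        meets no member of \<open>C i\<close>; any of its points then shows that the union grows
        strictly.\<close>
      have disj: "pairwise disjnt (a_rcosets\<^bsub>M\<^esub> N)"
        using M.add.rcos_disjoint[of N] N by (simp add: submodule_def A_RCOSETS_def)
      obtain x where x: "x \<in> carrier M" "X = N +>\<^bsub>M\<^esub> x" using X sub rcosets_iff[OF N] by blast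
      have "\<zero>\<^bsub>M\<^esub> \<oplus>\<^bsub>M\<^esub> x \<in> X"
        using x N unfolding submodule_iff a_r_coset_def' by blast
      moreover have "disjnt X Y" if "Y \<in> C i" for Y
        using disj X sub that by (metis pairwiseD subsetD)
      ultimately have "\<zero>\<^bsub>M\<^esub> \<oplus>\<^bsub>M\<^esub> x \<in> \<Union>(C (Suc i))" "\<zero>\<^bsub>M\<^esub> \<oplus>\<^bsub>M\<^esub> x \<notin> \<Union>(C i)"
        using X by (auto simp: disjnt_iff)
      then show ?thesis using C(2)[OF i] by blast
    qed
    then have "submodule_chain R M N n (\<lambda>i. \<Union>(C i))"
      using C submodule_Union_quot[OF N] by (simp add: submodule_chain_def)
    then show "\<exists>C. submodule_chain R M N n C" by (rule exI[of _ "\<lambda>i. \<Union>(C i)"])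
  next
    assume "\<exists>C. submodule_chain R M N n C"
    then obtain C where C: "submodule_chain R M N n C" ..
    show "\<exists>C. (\<forall>i\<le>n. submodule (C i) R (quot_module M N)) \<and> (\<forall>i<n. C i \<subset> C (Suc i))"
      by (rule exI[of _ "\<lambda>i. (\<lambda>x. N +>\<^bsub>M\<^esub> x) ` C i"])
        (use C submodule_image_quot[OF N] submodule_image_quot_strict[OF N] in
          \<open>simp add: submodule_chain_def\<close>)
  qed
  then show ?thesis by (simp add: module_length_def)
qed

context
  fixes f
  assumes f_closed: "\<And>x. x \<in> carrier M \<Longrightarrow> f x \<in> carrier M"
    and f_add: "\<And>x y. x \<in> carrier M \<Longrightarrow> y \<in> carrier M \<Longrightarrow> f (x \<oplus>\<^bsub>M\<^esub> y) = f x \<oplus>\<^bsub>M\<^esub> f y"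
    and f_smult: "\<And>a x. a \<in> carrier R \<Longrightarrow> x \<in> carrier M \<Longrightarrow> f (a \<odot>\<^bsub>M\<^esub> x) = a \<odot>\<^bsub>M\<^esub> f x"
begin

lemma submodule_image:
  assumes "submodule L R M"
  shows "submodule (f ` L) R M"
proof -
  have L: "L \<subseteq> carrier M" using assms by (simp add: submodule_iff)
  have "f \<zero>\<^bsub>M\<^esub> = f (\<zero> \<odot>\<^bsub>M\<^esub> \<zero>\<^bsub>M\<^esub>)" by simp
  also have "\<dots> = \<zero>\<^bsub>M\<^esub>" by (subst f_smult) (auto simp: f_closed)
  finally have "\<zero>\<^bsub>M\<^esub> \<in> f ` L" using assms by (metis imageI submodule_iff)
  then show ?thesis
    using assms L f_closed unfolding submodule_iff
    by (auto simp: subset_iff simp flip: f_add f_smult)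
qed

lemma submodule_chain_image:
  assumes C: "submodule_chain R M N n C" and inj: "inj_on f (carrier M)"
  shows "submodule_chain R M (f ` N) n (\<lambda>i. f ` C i)"
proof -
  have "f ` C i \<subset> f ` C (Suc i)" if "i < n" for i
  proof -
    have "C i \<subset> C (Suc i)" "C (Suc i) \<subseteq> carrier M"
      using C that by (auto simp: submodule_chain_def submodule_iff)
    then show ?thesis using inj by (intro image_strict_mono) (auto intro: inj_on_subset)
  qed
  then show ?thesis using C submodule_image by (simp add: submodule_chain_def image_mono)
qed

end

lemma module_length_quot_iso:
  assumes N: "submodule N R M"
    and f: "\<And>x. x \<in> carrier M \<Longrightarrow> f x \<in> carrier M"
      "\<And>x y. x \<in> carrier M \<Longrightarrow> y \<in> carrier M \<Longrightarrow> f (x \<oplus>\<^bsub>M\<^esub> y) = f x \<oplus>\<^bsub>M\<^esub> f y"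
      "\<And>a x. a \<in> carrier R \<Longrightarrow> x \<in> carrier M \<Longrightarrow> f (a \<odot>\<^bsub>M\<^esub> x) = a \<odot>\<^bsub>M\<^esub> f x"
    and g: "\<And>x. x \<in> carrier M \<Longrightarrow> g x \<in> carrier M"
      "\<And>x y. x \<in> carrier M \<Longrightarrow> y \<in> carrier M \<Longrightarrow> g (x \<oplus>\<^bsub>M\<^esub> y) = g x \<oplus>\<^bsub>M\<^esub> g y"
      "\<And>a x. a \<in> carrier R \<Longrightarrow> x \<in> carrier M \<Longrightarrow> g (a \<odot>\<^bsub>M\<^esub> x) = a \<odot>\<^bsub>M\<^esub> g x"
    and gf: "\<And>x. x \<in> carrier M \<Longrightarrow> g (f x) = x" "\<And>x. x \<in> carrier M \<Longrightarrow> f (g x) = x"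
  shows "module_length R (quot_module M (f ` N)) = module_length R (quot_module M N)"
proof -
  have fN: "submodule (f ` N) R M" using N by (intro submodule_image f)
  have "inj_on f (carrier M)" using gf(1) by (rule inj_on_inverseI)
  then have 1: "\<exists>C. submodule_chain R M (f ` N) n C" if "submodule_chain R M N n C" for n C
    by (intro exI) (rule submodule_chain_image[OF f that])
  have "inj_on g (carrier M)" using gf(2) by (rule inj_on_inverseI)
  then have "\<exists>C. submodule_chain R M (g ` f ` N) n C" if "submodule_chain R M (f ` N) n C" for n C
    by (intro exI) (rule submodule_chain_image[OF g that])
  moreover have "g ` f ` N = N"
  proof -
    have "g (f x) = x" if "x \<in> N" for x using N that by (auto simp: submodule_iff intro: gf(1))
    then show ?thesis unfolding image_image by simp
  qed
  ultimately have "(\<exists>C. submodule_chain R M (f ` N) n C) \<longleftrightarrow> (\<exists>C. submodule_chain R M N n C)" for n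
    using 1 by auto
  then show ?thesis by (simp only: module_length_quot[OF N] module_length_quot[OF fN])
qed

end

section \<open>Integral matrices\<close>

text \<open>Arbitrary bounds \<open>c i j\<close> are allowed because lowering a single bound, as
  the chains below do, destroys the shape \<open>min (a i) (b j)\<close>.\<close>

definition val_mats ::
  "('k::field \<Rightarrow> int extended) \<Rightarrow> nat \<Rightarrow> nat \<Rightarrow> (nat \<Rightarrow> nat \<Rightarrow> int extended) \<Rightarrow> 'k mat set" where
  "val_mats val r t c = {M \<in> int_mats val r t. \<forall>i<r. \<forall>j<t. c i j \<le> val (M $$ (i, j))}"

lemma int_matsD:
  assumes "M \<in> int_mats val m n"
  shows "M \<in> carrier_mat m n" "dim_row M = m" "dim_col M = n"
    "\<And>i j. i < m \<Longrightarrow> j < n \<Longrightarrow> M $$ (i, j) \<in> val_integers val"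
  using assms by (auto simp: int_mats_def)

lemma int_mat_module_simps [simp]:
  "carrier (int_mat_module val m n) = int_mats val m n"
  "zero (int_mat_module val m n) = 0\<^sub>m m n"
  "add (int_mat_module val m n) = (+)"
  "smult (int_mat_module val m n) = (\<cdot>\<^sub>m)"
  by (simp_all add: int_mat_module_def module_mat_def)

lemma val_ring_simps [simp]:
  "carrier (val_ring val) = val_integers val"
  "monoid.mult (val_ring val) = (*)"
  "one (val_ring val) = 1"
  "zero (val_ring val) = 0"
  "add (val_ring val) = (+)"
  by (simp_all add: val_ring_def)

lemma sum_Fin:
  fixes f :: "'a \<Rightarrow> 'b::comm_monoid_add"
  shows "(\<Sum>i\<in>I. Fin (f i)) = Fin (\<Sum>i\<in>I. f i)"
  by (induction I rule: infinite_finite_induct) (simp_all add: zero_extended_def)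

lemma Pinf_add [simp]:
  fixes x :: "'b::plus extended"
  shows "Pinf + x = Pinf" "x + Pinf = Pinf"
  by (cases x; simp)+

lemma sum_Pinf:
  fixes f :: "'a \<Rightarrow> 'b::comm_monoid_add extended"
  assumes "finite I" "i \<in> I" "f i = Pinf"
  shows "(\<Sum>i\<in>I. f i) = Pinf"
  using assms by (simp add: sum.remove[of I i])

text \<open>Conditions on dimensions, here and in the two distributive laws that follow, leave no
  matrix sizes to be instantiated when the simplifier rewrites.\<close>

lemma assoc_mult_mat_dim:
  fixes A B C :: "'a::semiring_0 mat"
  shows "dim_col A = dim_row B \<Longrightarrow> dim_col B = dim_row C \<Longrightarrow> A * B * C = A * (B * C)"
  by (rule assoc_mult_mat[of A "dim_row A" "dim_col A" B "dim_col B" C "dim_col C"]) auto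

lemma mult_add_distrib_mat_dim:
  fixes A B C :: "'a::semiring_0 mat"
  shows "dim_col A = dim_row B \<Longrightarrow> dim_row B = dim_row C \<Longrightarrow> dim_col B = dim_col C \<Longrightarrow>
    A * (B + C) = A * B + A * C"
  by (rule mult_add_distrib_mat[of A "dim_row A" "dim_col A" B "dim_col B" C]) auto

lemma add_mult_distrib_mat_dim:
  fixes A B C :: "'a::semiring_0 mat"
  shows "dim_row A = dim_row B \<Longrightarrow> dim_col A = dim_col B \<Longrightarrow> dim_col A = dim_row C \<Longrightarrow>
    (A + B) * C = A * C + B * C"
  by (rule add_mult_distrib_mat[of A "dim_row A" "dim_col A" B C "dim_col C"]) auto

lemma mult_cancel_left_mat:
  fixes U W X :: "'a::semiring_1 mat"
  assumes "U * W = 1\<^sub>m n" "U \<in> carrier_mat n n" "W \<in> carrier_mat n n" "dim_row X = n"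
  shows "U * (W * X) = X"
proof -
  have "U * (W * X) = (U * W) * X" using assms by (intro assoc_mult_mat_dim[symmetric]) auto
  then show ?thesis using assms by simp
qed

text \<open>Only the summand \<open>k = i\<close> can be nonzero, and it occurs only for
  \<open>i < n\<close>. The value 0 beyond that matches the value \<open>Pinf\<close> of
  \<open>diag_val\<close>.\<close>

lemma index_diagonal_mult_mat:
  fixes D X :: "'a::semiring_0 mat"
  assumes "diagonal_mat D" "D \<in> carrier_mat m n" "X \<in> carrier_mat n p" "i < m" "j < p"
  shows "(D * X) $$ (i, j) = (if i < n then D $$ (i, i) * X $$ (i, j) else 0)"
proof -
  have "(D * X) $$ (i, j) = (\<Sum>k = 0..<n. D $$ (i, k) * X $$ (k, j))"
    using assms by (simp add: scalar_prod_def)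
  also have "\<dots> = (\<Sum>k = 0..<n. if k = i then D $$ (i, i) * X $$ (i, j) else 0)"
    using assms by (intro sum.cong) (auto simp: diagonal_mat_def)
  finally show ?thesis by simp
qed

lemma index_mult_diagonal_mat:
  fixes D X :: "'a::semiring_0 mat"
  assumes "diagonal_mat D" "D \<in> carrier_mat n p" "X \<in> carrier_mat m n" "i < m" "j < p"
  shows "(X * D) $$ (i, j) = (if j < n then X $$ (i, j) * D $$ (j, j) else 0)"
proof -
  have "(X * D) $$ (i, j) = (\<Sum>k = 0..<n. X $$ (i, k) * D $$ (k, j))"
    using assms by (simp add: scalar_prod_def)
  also have "\<dots> = (\<Sum>k = 0..<n. if k = j then X $$ (i, j) * D $$ (j, j) else 0)"
    using assms by (intro sum.cong) (auto simp: diagonal_mat_def)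
  finally show ?thesis by simp
qed

text \<open>Inserting \<open>UA * UA'\<close> before \<open>dA\<close> and \<open>VB' * VB\<close>
  after \<open>dB\<close> exposes the common outer factors \<open>UA\<close> and \<open>VB\<close>;
  the inner factors \<open>VA\<close> and \<open>UB\<close> are absorbed into the arguments.\<close>

lemma mult_differential_conj:
  fixes DA DB :: "'k::field mat"
  assumes carr: "UA \<in> carrier_mat r r" "UA' \<in> carrier_mat r r" "VA \<in> carrier_mat s s"
      "UB \<in> carrier_mat s s" "VB \<in> carrier_mat t t" "VB' \<in> carrier_mat t t"
      "DA \<in> carrier_mat r s" "DB \<in> carrier_mat s t"
      "dA \<in> carrier_mat r s" "dB \<in> carrier_mat s t"
    and inv: "UA * UA' = 1\<^sub>m r" "VB' * VB = 1\<^sub>m t"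
  shows "mult_differential (UA * DA * VA) (UB * DB * VB) (dA, dB)
    = UA * mult_differential DA DB (UA' * dA * UB, VA * dB * VB') * VB"
proof -
  note UA = mult_cancel_left_mat[OF inv(1) carr(1,2)]
  show ?thesis
    using carr inv
    by (simp add: mult_differential_def assoc_mult_mat_dim mult_add_distrib_mat_dim
        add_mult_distrib_mat_dim UA)
qed

lemma min_mats_eq_val_mats: "min_mats val r t a b = val_mats val r t (\<lambda>i j. min (a i) (b j))"
  by (simp add: min_mats_def val_mats_def)

section \<open>Elementary properties of the valuation\<close>

context complete_discrete_valuation
begin

lemma val_zero [simp]: "val 0 = Pinf"
  by (simp add: val_eq_Pinf)

lemma ex_val: "\<exists>x. val x = Fin n"
  using val_range by (metis UNIV_I image_iff insertCI)

lemma nonzero_val: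
  assumes "x \<noteq> 0"
  obtains n where "val x = Fin n"
  using assms val_range val_eq_Pinf by (metis imageE insertE rangeI)

lemma val_one [simp]: "val 1 = 0"
proof -
  obtain n where "val 1 = Fin n" using nonzero_val[of 1] by auto
  then show ?thesis using val_mult[of 1 1] by (simp add: zero_extended_def)
qed

lemma val_uminus [simp]: "val (- x) = val x"
proof -
  obtain n where n: "val (- 1) = Fin n" using nonzero_val[of "- 1"] by auto
  then have "val (- 1) = 0" using val_mult[of "- 1" "- 1"] by (simp add: zero_extended_def)
  then show ?thesis using val_mult[of "- 1" x] by simp
qed

lemma le_val_add: "a \<le> val x \<Longrightarrow> a \<le> val y \<Longrightarrow> a \<le> val (x + y)"
  using val_add[of x y] by (meson min.boundedI order_trans)

lemma le_val_mult:
  assumes "x \<in> val_integers val" "a \<le> val y"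
  shows "a \<le> val (x * y)"
  using assms add_mono[of 0 "val x" a "val y"] by (simp add: val_integers_def val_mult)

text \<open>Divisibility among elements is comparison of valuations. For \<open>x = 0\<close> the
  hypothesis forces \<open>y = 0\<close>, and division by zero yields 0, so zero diagonal entries
  are covered too.\<close>

lemma divide_in_val_integers:
  assumes "val x \<le> val y"
  shows "y / x \<in> val_integers val" "x * (y / x) = y"
proof -
  show *: "x * (y / x) = y" using assms by (cases "x = 0") (simp_all add: val_eq_Pinf)
  show "y / x \<in> val_integers val"
  proof (cases "x = 0")
    case True
    then show ?thesis by (simp add: val_integers_def)
  next
    case False
    then obtain n where "val x = Fin n" by (rule nonzero_val)
    then show ?thesis using assms val_mult[of x "y / x"] *
      by (cases "val (y / x)") (auto simp: val_integers_def zero_extended_def)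
  qed
qed

lemma val_integers_closed [simp]:
  "0 \<in> val_integers val" "1 \<in> val_integers val"
  "x \<in> val_integers val \<Longrightarrow> - x \<in> val_integers val"
  "x \<in> val_integers val \<Longrightarrow> y \<in> val_integers val \<Longrightarrow> x + y \<in> val_integers val"
  "x \<in> val_integers val \<Longrightarrow> y \<in> val_integers val \<Longrightarrow> x * y \<in> val_integers val"
  using le_val_add[of 0 x y] le_val_mult[of x 0 y] by (simp_all add: val_integers_def)

lemma sum_in_val_integers: "(\<And>i. i \<in> I \<Longrightarrow> f i \<in> val_integers val) \<Longrightarrow> sum f I \<in> val_integers val"
  by (induction I rule: infinite_finite_induct) simp_all

section \<open>Integral matrices as a module over the valuation ring\<close>

lemma mult_in_int_mats:
  assumes "A \<in> int_mats val m n" "B \<in> int_mats val n p"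
  shows "A * B \<in> int_mats val m p"
  using assms unfolding int_mats_def
  by (auto simp: scalar_prod_def intro!: sum_in_val_integers)

lemma cring_val_ring: "cring (val_ring val)"
proof (intro cringI abelian_groupI comm_monoidI)
  fix x assume "x \<in> carrier (val_ring val)"
  then show "\<exists>y\<in>carrier (val_ring val). y \<oplus>\<^bsub>val_ring val\<^esub> x = \<zero>\<^bsub>val_ring val\<^esub>"
    by (intro bexI[of _ "- x"]) simp_all
qed (simp_all add: algebra_simps)

lemma module_int_mat: "module (val_ring val) (int_mat_module val m n)"
proof (rule moduleI)
  show "abelian_group (int_mat_module val m n)"
  proof (rule abelian_groupI)
    fix X assume "X \<in> carrier (int_mat_module val m n)"
    then show "\<exists>Y\<in>carrier (int_mat_module val m n).
      Y \<oplus>\<^bsub>int_mat_module val m n\<^esub> X = \<zero>\<^bsub>int_mat_module val m n\<^esub>"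
      by (intro bexI[of _ "- X"]) (auto simp: int_mats_def)
  qed (auto simp: int_mats_def algebra_simps)
qed (auto simp: cring_val_ring int_mats_def algebra_simps)

lemma submodule_int_mat_iff:
  "submodule L (val_ring val) (int_mat_module val m n) \<longleftrightarrow>
     L \<subseteq> int_mats val m n \<and> 0\<^sub>m m n \<in> L \<and> (\<forall>X\<in>L. \<forall>Y\<in>L. X + Y \<in> L) \<and>
     (\<forall>a\<in>val_integers val. \<forall>X\<in>L. a \<cdot>\<^sub>m X \<in> L)"
  using module.submodule_iff[OF module_int_mat] by simp

section \<open>Entrywise valuation bounds and chains of submodules\<close>

lemma submodule_val_mats: "submodule (val_mats val m n c) (val_ring val) (int_mat_module val m n)"
  unfolding submodule_int_mat_iff
  by (auto simp: val_mats_def int_mats_def intro!: le_val_add le_val_mult)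

lemma val_mats_antimono:
  "(\<And>i j. i < r \<Longrightarrow> j < t \<Longrightarrow> d i j \<le> c i j) \<Longrightarrow> val_mats val r t c \<subseteq> val_mats val r t d"
  unfolding val_mats_def by (blast intro: order_trans)

text \<open>Lowering one positive bound by one enlarges the submodule strictly, and this can be
  repeated until all bounds are 0. The induction puts the submodule for \<open>d\<close> in front of
  a chain for the lowered bounds.\<close>

lemma ex_submodule_chain:
  fixes d :: "nat \<Rightarrow> nat \<Rightarrow> nat"
  assumes "(\<Sum>i<r. \<Sum>j<t. d i j) = n"
  shows "\<exists>C. submodule_chain (val_ring val) (int_mat_module val r t)
    (val_mats val r t (\<lambda>i j. Fin (int (d i j)))) n C"
  using assms
proof (induction n arbitrary: d)
  case 0
  show ?case
    by (rule exI[of _ "\<lambda>_. val_mats val r t (\<lambda>i j. Fin (int (d i j)))"])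
      (simp add: submodule_chain_def submodule_val_mats)
next
  case (Suc n)
  let ?box = "\<lambda>d. val_mats val r t (\<lambda>i j. Fin (int (d i j)))"
  have "\<exists>i<r. \<exists>j<t. d i j \<noteq> 0"
  proof (rule ccontr)
    assume "\<not> ?thesis"
    then have "(\<Sum>i<r. \<Sum>j<t. d i j) = 0" by simp
    then show False using Suc.prems by simp
  qed
  then obtain i j where ij: "i < r" "j < t" "d i j \<noteq> 0" by auto
  define d' where "d' = d(i := (d i)(j := d i j - 1))"
  have "(\<Sum>j<t. d i j) = Suc (\<Sum>j<t. d' i j)"
    using ij by (simp add: d'_def sum.remove[of "{..<t}" j])
  moreover have "(\<Sum>i\<in>{..<r} - {i}. \<Sum>j<t. d' i j) = (\<Sum>i\<in>{..<r} - {i}. \<Sum>j<t. d i j)"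
    by (intro sum.cong) (simp_all add: d'_def)
  ultimately have "(\<Sum>i<r. \<Sum>j<t. d' i j) = n"
    using ij Suc.prems by (simp add: sum.remove[of "{..<r}" i])
  then obtain C where C: "submodule_chain (val_ring val) (int_mat_module val r t) (?box d') n C"
    using Suc.IH by blast
  \<comment> \<open>A matrix whose single nonzero entry has valuation exactly
    \<open>d i j - 1\<close> separates the two submodules.\<close>
  obtain x where x: "val x = Fin (int (d' i j))" using ex_val by blast
  define X where "X = mat r t (\<lambda>p. if p = (i, j) then x else 0)"
  have "X \<in> ?box d'" "X \<notin> ?box d"
    using x ij by (auto simp: X_def val_mats_def int_mats_def val_integers_def zero_extended_def d'_def)
  moreover have "?box d \<subseteq> ?box d'"
    by (intro val_mats_antimono) (simp add: d'_def)
  ultimately have lt: "?box d \<subset> ?box d'" by blast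
  show ?case
  proof (rule exI)
    show "submodule_chain (val_ring val) (int_mat_module val r t) (?box d) (Suc n)
      (\<lambda>k. case k of 0 \<Rightarrow> ?box d | Suc k \<Rightarrow> C k)"
    using C lt unfolding submodule_chain_def
    by (auto simp: submodule_val_mats split: nat.splits)
  qed
qed

text \<open>Matrix positions are ordered row by row; \<open>i * t + j\<close> is the rank of \<open>(i, j)\<close>.\<close>

definition leading :: "nat \<Rightarrow> nat \<Rightarrow> (nat \<Rightarrow> nat \<Rightarrow> nat) \<Rightarrow> 'k mat set \<Rightarrow> ((nat \<times> nat) \<times> nat) set" where
  "leading r t d L = {((i, j), v). i < r \<and> j < t \<and> v < d i j \<and>
     (\<exists>X\<in>L. val (X $$ (i, j)) = Fin (int v) \<and>
        (\<forall>i'<r. \<forall>j'<t. i' * t + j' < i * t + j \<longrightarrow> X $$ (i', j') = 0))}"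

lemma leading_subset: "leading r t d L \<subseteq> (SIGMA p : {..<r} \<times> {..<t}. {..<d (fst p) (snd p)})"
  by (auto simp: leading_def)

lemma leading_mono: "L \<subseteq> L' \<Longrightarrow> leading r t d L \<subseteq> leading r t d L'"
  unfolding leading_def by (intro subsetI) (clarsimp, meson subsetD)

text \<open>Gaussian elimination: the entries of an element of \<open>L'\<close> are cleared in
  order of rank by subtracting elements of \<open>L\<close>. An entry of valuation at least
  \<open>d i j\<close> is cleared by a matrix from the box; one of smaller valuation gives a leading
  pair of \<open>L'\<close>, which by \<open>lead\<close> also occurs in \<open>L\<close>.\<close>

lemma leading_eqD:
  assumes L: "submodule L (val_ring val) (int_mat_module val r t)"
    and L': "submodule L' (val_ring val) (int_mat_module val r t)"
    and sub: "L \<subseteq> L'" and box: "val_mats val r t (\<lambda>i j. Fin (int (d i j))) \<subseteq> L"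
    and lead: "leading r t d L' \<subseteq> leading r t d L"
  shows "L' = L"
proof -
  \<comment> \<open>All positions of rank below \<open>k\<close> are already cleared. The induction
    descends from \<open>k = r * t\<close>, where \<open>X\<close> is zero, to \<open>k = 0\<close>,
    where nothing is assumed about the entries.\<close>
  have "X \<in> L" if "k \<le> r * t" "X \<in> L'"
    "\<And>i j. i < r \<Longrightarrow> j < t \<Longrightarrow> i * t + j < k \<Longrightarrow> X $$ (i, j) = 0" for k X
    using that
  proof (induction k arbitrary: X rule: inc_induct)
    case base
    have "X \<in> carrier_mat r t" using base L' by (auto simp: submodule_int_mat_iff int_mats_def)
    moreover have "i * t + j < r * t" if "i < r" "j < t" for i j
    proof -
      have "i * t + j < Suc i * t" using that by simp
      also have "\<dots> \<le> r * t" using that by (intro mult_le_mono1) simp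
      finally show ?thesis .
    qed
    ultimately have "X = 0\<^sub>m r t" using base by (intro eq_matI) auto
    then show ?case using L by (simp add: submodule_int_mat_iff)
  next
    case (step k)
    \<comment> \<open>Division with remainder by \<open>t\<close> recovers the position of rank
      \<open>k\<close>; \<open>uniq\<close> below excludes any other position of that rank.\<close>
    define i j where "i = k div t" and "j = k mod t"
    have t: "0 < t" using step.hyps by (cases t) auto
    then have ij: "i < r" "j < t" "k = i * t + j"
      using step.hyps by (auto simp: i_def j_def less_mult_imp_div_less)
    have uniq: "i' = i \<and> j' = j" if "j' < t" "i' * t + j' = k" for i' j'
      using that t by (auto simp: i_def j_def)
    have X: "X \<in> int_mats val r t" using step.prems L' by (auto simp: submodule_int_mat_iff)
    \<comment> \<open>The pivot \<open>E\<close> agrees with \<open>X\<close> at rank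
      \<open>k\<close> and does not disturb the positions already cleared.\<close>
    have "\<exists>E\<in>L. E $$ (i, j) = X $$ (i, j) \<and> (\<forall>i'<r. \<forall>j'<t. i' * t + j' < k \<longrightarrow> E $$ (i', j') = 0)"
    proof (cases "Fin (int (d i j)) \<le> val (X $$ (i, j))")
      case True
      define E where "E = mat r t (\<lambda>p. if p = (i, j) then X $$ (i, j) else 0)"
      have "E \<in> val_mats val r t (\<lambda>i j. Fin (int (d i j)))"
        using True X ij by (auto simp: E_def val_mats_def int_mats_def)
      then show ?thesis using box ij by (intro bexI[of _ E]) (auto simp: E_def)
    next
      case False
      then have "X $$ (i, j) \<noteq> 0" by auto
      then obtain n where n: "val (X $$ (i, j)) = Fin n" using nonzero_val by blast
      have "0 \<le> n" using int_matsD(4)[OF X ij(1,2)] n by (simp add: val_integers_def zero_extended_def)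
      then obtain v where v: "n = int v" using nonneg_int_cases by blast
      have "((i, j), v) \<in> leading r t d L'"
        using ij n v False step.prems by (auto simp: leading_def intro!: bexI[of _ X])
      then have "((i, j), v) \<in> leading r t d L" using lead by blast
      then obtain Y where Y: "Y \<in> L" "val (Y $$ (i, j)) = Fin (int v)"
        "\<And>i' j'. i' < r \<Longrightarrow> j' < t \<Longrightarrow> i' * t + j' < k \<Longrightarrow> Y $$ (i', j') = 0"
        by (auto simp: leading_def ij(3))
      have Yc: "Y \<in> carrier_mat r t" using Y L by (auto simp: submodule_int_mat_iff int_mats_def)
      \<comment> \<open>Both entries have valuation \<open>v\<close>, so this quotient is integral
        and rescaling \<open>Y\<close> by it stays in \<open>L\<close>.\<close>
      define a where "a = X $$ (i, j) / Y $$ (i, j)"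
      have "a \<in> val_integers val"
        using Y n v by (simp add: a_def divide_in_val_integers)
      then have "a \<cdot>\<^sub>m Y \<in> L" using Y L by (simp add: submodule_int_mat_iff)
      moreover have "Y $$ (i, j) \<noteq> 0" using Y by auto
      ultimately show ?thesis using Y Yc ij by (intro bexI[of _ "a \<cdot>\<^sub>m Y"]) (auto simp: a_def)
    qed
    then obtain E where E: "E \<in> L" "E $$ (i, j) = X $$ (i, j)"
      "\<And>i' j'. i' < r \<Longrightarrow> j' < t \<Longrightarrow> i' * t + j' < k \<Longrightarrow> E $$ (i', j') = 0" by blast
    have Xc: "X \<in> carrier_mat r t" and Ec: "E \<in> carrier_mat r t"
      using X E L by (auto simp: submodule_int_mat_iff int_mats_def)
    \<comment> \<open>The difference vanishes through rank \<open>k\<close>, so the induction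
      hypothesis puts it in \<open>L\<close>; adding \<open>E\<close> back gives \<open>X\<close>.
      It is written with the scalar \<open>- 1\<close> to match the closure properties of a
      submodule.\<close>
    define Z where "Z = X + (- 1) \<cdot>\<^sub>m E"
    have "(- 1) \<cdot>\<^sub>m E \<in> L'" using E sub L' by (auto simp: submodule_int_mat_iff)
    then have "Z \<in> L'" unfolding Z_def using step.prems L' by (simp add: submodule_int_mat_iff)
    moreover have "Z $$ (i', j') = 0" if "i' < r" "j' < t" "i' * t + j' < Suc k" for i' j'
    proof (cases "i' * t + j' = k")
      case True
      then show ?thesis using uniq[OF that(2)] that E Xc Ec by (simp add: Z_def)
    next
      case False
      then show ?thesis using that E step.prems Xc Ec by (simp add: Z_def)
    qed
    ultimately have "Z \<in> L" by (rule step.IH)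
    moreover have "X = Z + E" using Xc Ec by (intro eq_matI) (auto simp: Z_def)
    ultimately show ?case using E L by (simp add: submodule_int_mat_iff)
  qed
  from this[of 0] show ?thesis using sub by auto
qed

text \<open>By \<open>leading_eqD\<close> the set of leading pairs grows strictly along the chain,
  so its last set has at least \<open>n\<close> elements.\<close>

lemma submodule_chain_length_le:
  assumes C: "submodule_chain (val_ring val) (int_mat_module val r t)
    (val_mats val r t (\<lambda>i j. Fin (int (d i j)))) n C"
  shows "n \<le> (\<Sum>i<r. \<Sum>j<t. d i j)"
proof -
  have fin: "finite (leading r t d L)" for L
    by (rule finite_subset[OF leading_subset]) auto
  have strict: "leading r t d (C k) \<subset> leading r t d (C (Suc k))" if "k < n" for k
  proof -
    have k: "submodule (C k) (val_ring val) (int_mat_module val r t)"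
      "submodule (C (Suc k)) (val_ring val) (int_mat_module val r t)"
      "C k \<subset> C (Suc k)" "val_mats val r t (\<lambda>i j. Fin (int (d i j))) \<subseteq> C k"
      using C that by (auto simp: submodule_chain_def)
    then have "leading r t d (C k) \<subseteq> leading r t d (C (Suc k))"
      by (intro leading_mono) auto
    then show ?thesis using leading_eqD[OF k(1,2) _ k(4)] k(3) by blast
  qed
  have "k \<le> card (leading r t d (C k))" if "k \<le> n" for k
    using that
  proof (induction k)
    case (Suc k)
    then show ?case using psubset_card_mono[OF fin strict, of k] by simp
  qed simp
  then have "n \<le> card (leading r t d (C n))" by simp
  \<comment> \<open>Each position \<open>p\<close> admits only the valuations below its bound, and
    summing their numbers over all positions gives the total.\<close>
  also have "\<dots> \<le> card (SIGMA p : {..<r} \<times> {..<t}. {..<d (fst p) (snd p)})"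
    by (intro card_mono leading_subset) auto
  also have "\<dots> = (\<Sum>i<r. \<Sum>j<t. d i j)"
    by (simp only: sum.cartesian_product case_prod_unfold) simp
  finally show ?thesis .
qed

text \<open>For finite bounds the explicit chain attains the upper bound on chain lengths. With an
  infinite bound, finite truncations give chains of every length, and both sides are
  infinite.\<close>

lemma module_length_quot_val_mats:
  assumes c: "\<And>i j. i < r \<Longrightarrow> j < t \<Longrightarrow> 0 \<le> c i j"
  shows "extended_of_enat (module_length (val_ring val)
    (quot_module (int_mat_module val r t) (val_mats val r t c))) = (\<Sum>i<r. \<Sum>j<t. c i j)"
proof -
  let ?chain = "\<lambda>c. submodule_chain (val_ring val) (int_mat_module val r t) (val_mats val r t c)"
  have len: "module_length (val_ring val) (quot_module (int_mat_module val r t) (val_mats val r t c))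
    = (SUP n \<in> {n. \<exists>C. ?chain c n C}. enat n)"
    by (rule module.module_length_quot[OF module_int_mat submodule_val_mats])
  \<comment> \<open>Finite bounds \<open>d\<close> below \<open>c\<close> define a larger submodule,
    so a chain above it is also a chain above the one for \<open>c\<close>.\<close>
  have ex_chain: "\<exists>C. ?chain c (\<Sum>i<r. \<Sum>j<t. d i j) C"
    if "\<And>i j. i < r \<Longrightarrow> j < t \<Longrightarrow> Fin (int (d i j)) \<le> c i j" for d
  proof -
    have "val_mats val r t c \<subseteq> val_mats val r t (\<lambda>i j. Fin (int (d i j)))"
      by (rule val_mats_antimono) (rule that)
    then show ?thesis
      using ex_submodule_chain[OF refl, where d = d and r = r and t = t] submodule_chain_mono by blast
  qed
  show ?thesis
  proof (cases "\<exists>i<r. \<exists>j<t. c i j = Pinf")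
    case True
    then obtain i j where ij: "i < r" "j < t" "c i j = Pinf" by auto
    have "\<exists>C. ?chain c n C" for n
    proof -
      \<comment> \<open>The whole length \<open>n\<close> is placed at the position with the
        infinite bound.\<close>
      let ?d = "\<lambda>i' j'. if i' = i \<and> j' = j then n else 0"
      have "(\<Sum>i'<r. \<Sum>j'<t. ?d i' j') = (\<Sum>i'<r. if i' = i then n else 0)"
        using ij by (intro sum.cong) auto
      also have "\<dots> = n" using ij by simp
      finally show ?thesis using ex_chain[of ?d] c ij by (simp add: zero_extended_def)
    qed
    then have "(SUP n \<in> {n. \<exists>C. ?chain c n C}. enat n) = (SUP n. enat n)" by simp
    also have "\<dots> = \<infinity>"
    proof (rule ccontr)
      assume "(SUP n. enat n) \<noteq> \<infinity>"
      then obtain k where "(SUP n. enat n) = enat k" by auto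
      then have "enat (Suc k) \<le> enat k" by (metis SUP_upper UNIV_I)
      then show False by simp
    qed
    moreover have "(\<Sum>i<r. \<Sum>j<t. c i j) = Pinf"
      using ij by (intro sum_Pinf[of _ i] sum_Pinf[of _ j]) auto
    ultimately show ?thesis by (simp add: len)
  next
    case False
    \<comment> \<open>For indices in range, \<open>c i j\<close> is neither negative nor infinite,
      so neither the default 0 nor the truncation by \<open>nat\<close> changes any value
      there.\<close>
    define d where "d i j = (case c i j of Fin x \<Rightarrow> nat x | _ \<Rightarrow> 0)" for i j
    have d: "c i j = Fin (int (d i j))" if "i < r" "j < t" for i j
      using c[OF that] False that by (cases "c i j") (auto simp: d_def zero_extended_def)
    have box: "val_mats val r t c = val_mats val r t (\<lambda>i j. Fin (int (d i j)))"
      using d by (auto simp: val_mats_def)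
    have "(SUP n \<in> {n. \<exists>C. ?chain c n C}. enat n) = enat (\<Sum>i<r. \<Sum>j<t. d i j)"
    proof (intro SUP_eqI)
      fix n assume "n \<in> {n. \<exists>C. ?chain c n C}"
      then show "enat n \<le> enat (\<Sum>i<r. \<Sum>j<t. d i j)"
        unfolding box using submodule_chain_length_le by auto
    next
      fix y assume "\<And>n. n \<in> {n. \<exists>C. ?chain c n C} \<Longrightarrow> enat n \<le> y"
      then show "enat (\<Sum>i<r. \<Sum>j<t. d i j) \<le> y" using ex_chain[of d] d by auto
    qed
    moreover have "(\<Sum>i<r. \<Sum>j<t. c i j) = Fin (int (\<Sum>i<r. \<Sum>j<t. d i j))"
      using d by (simp add: sum_Fin)
    ultimately show ?thesis by (simp add: len)
  qed
qed

section \<open>Smith decompositions and the image of the differential\<close>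

lemma int_GL_inverse:
  assumes "U \<in> int_GL val n"
  obtains W where "U \<in> int_mats val n n" "W \<in> int_mats val n n" "U * W = 1\<^sub>m n" "W * U = 1\<^sub>m n"
  using assms by (auto simp: int_GL_def)

lemma add_in_int_mats:
  "A \<in> int_mats val m n \<Longrightarrow> B \<in> int_mats val m n \<Longrightarrow> A + B \<in> int_mats val m n"
  by (auto simp: int_mats_def)

text \<open>The diagonal factor is recovered as \<open>U' * M * V'\<close> with integral inverses
  \<open>U'\<close> and \<open>V'\<close>, a product of integral matrices.\<close>

lemma smith_diagonal_integral:
  assumes "M \<in> int_mats val m n" "smith_decomposition val m n M U D V"
  shows "D \<in> int_mats val m n"
proof -
  obtain U' where U: "U \<in> int_mats val m m" "U' \<in> int_mats val m m" "U' * U = 1\<^sub>m m"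
    using assms int_GL_inverse unfolding smith_decomposition_def by metis
  obtain V' where V: "V \<in> int_mats val n n" "V' \<in> int_mats val n n" "V * V' = 1\<^sub>m n"
    using assms int_GL_inverse unfolding smith_decomposition_def by metis
  have D: "D \<in> carrier_mat m n" and M: "M = U * D * V"
    using assms by (auto simp: smith_decomposition_def)
  have "U' * M * V' = D"
    using U V D unfolding M
    by (simp add: int_matsD assoc_mult_mat_dim mult_cancel_left_mat[OF U(3) int_matsD(1)[OF U(2)] int_matsD(1)[OF U(1)]])
  moreover have "U' * M * V' \<in> int_mats val m n"
    using U V assms by (intro mult_in_int_mats)
  ultimately show ?thesis by simp
qed

lemma diag_val_nonneg:
  assumes "D \<in> int_mats val m n"
  shows "0 \<le> diag_val val D i"
  using int_matsD[OF assms] by (simp add: diag_val_def val_integers_def)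

text \<open>The conditions at different positions decouple: entry \<open>(i, j)\<close> of the image
  involves only the entries of \<open>X\<close> and \<open>Y\<close> at \<open>(i, j)\<close>. The
  integral combinations of two elements are the integral multiples of the one with smaller
  valuation.\<close>

lemma mult_differential_diagonal:
  assumes DA: "DA \<in> int_mats val r s" "diagonal_mat DA"
    and DB: "DB \<in> int_mats val s t" "diagonal_mat DB"
  shows "mult_differential DA DB ` (int_mats val r s \<times> int_mats val s t)
    = min_mats val r t (diag_val val DA) (diag_val val DB)" (is "?L = min_mats val r t ?a ?b")
proof
  note DAc = int_matsD(1-3)[OF DA(1)] and DBc = int_matsD(1-3)[OF DB(1)]
  have entry: "(DA * X + Y * DB) $$ (i, j) = (if i < s then DA $$ (i, i) * X $$ (i, j) else 0)
      + (if j < s then Y $$ (i, j) * DB $$ (j, j) else 0)"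
    if "X \<in> carrier_mat s t" "Y \<in> carrier_mat r s" "i < r" "j < t" for X Y i j
    using that DAc DBc index_diagonal_mult_mat[OF DA(2) DAc(1) that(1,3,4)]
      index_mult_diagonal_mat[OF DB(2) DBc(1) that(2,3,4)]
    by (simp del: index_mult_mat(1))
  show "?L \<subseteq> min_mats val r t ?a ?b"
  proof clarify
    fix Y X assume Y: "Y \<in> int_mats val r s" and X: "X \<in> int_mats val s t"
    have "DA * X + Y * DB \<in> int_mats val r t"
      using DA DB X Y by (intro add_in_int_mats mult_in_int_mats)
    moreover have "min (?a i) (?b j) \<le> val ((DA * X + Y * DB) $$ (i, j))" if ij: "i < r" "j < t" for i j
    proof -
      have "?a i \<le> val (DA $$ (i, i) * X $$ (i, j))" if "i < s"
        using that ij DAc le_val_mult[OF int_matsD(4)[OF X that ij(2)], of "?a i" "DA $$ (i, i)"]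
        by (simp add: diag_val_def mult.commute)
      moreover have "?b j \<le> val (Y $$ (i, j) * DB $$ (j, j))" if "j < s"
        using that ij DBc le_val_mult[OF int_matsD(4)[OF Y ij(1) that], of "?b j" "DB $$ (j, j)"]
        by (simp add: diag_val_def)
      ultimately show ?thesis
        unfolding entry[OF int_matsD(1)[OF X] int_matsD(1)[OF Y] ij]
        by (intro le_val_add) (auto simp: min_le_iff_disj)
    qed
    ultimately show "mult_differential DA DB (Y, X) \<in> min_mats val r t ?a ?b"
      by (simp add: mult_differential_def min_mats_def)
  qed
  show "min_mats val r t ?a ?b \<subseteq> ?L"
  proof
    fix M assume M: "M \<in> min_mats val r t ?a ?b"
    then have Mi: "M \<in> int_mats val r t"
      and Mv: "\<And>i j. i < r \<Longrightarrow> j < t \<Longrightarrow> min (?a i) (?b j) \<le> val (M $$ (i, j))"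
      by (auto simp: min_mats_def)
    \<comment> \<open>Each entry of \<open>M\<close> is divided by whichever of the two diagonal
      entries has the smaller valuation: \<open>X\<close> serves the positions with
      \<open>?a i \<le> ?b j\<close> and \<open>Y\<close> the others. The guards keep the indices
      inside \<open>M\<close>.\<close>
    define X where "X = mat s t (\<lambda>(i, j). if i < r \<and> ?a i \<le> ?b j then M $$ (i, j) / DA $$ (i, i) else 0)"
    define Y where "Y = mat r s (\<lambda>(i, j). if j < t \<and> \<not> ?a i \<le> ?b j then M $$ (i, j) / DB $$ (j, j) else 0)"
    have a: "val (DA $$ (i, i)) \<le> val (M $$ (i, j))" if "i < r" "i < s" "j < t" "?a i \<le> ?b j" for i j
    proof -
      have "?a i = val (DA $$ (i, i))" using that DAc by (simp add: diag_val_def)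
      then show ?thesis using Mv[of i j] that by (simp add: min_absorb1)
    qed
    have b: "val (DB $$ (j, j)) \<le> val (M $$ (i, j))" if "i < r" "j < s" "j < t" "\<not> ?a i \<le> ?b j" for i j
    proof -
      have "?b j = val (DB $$ (j, j))" using that DBc by (simp add: diag_val_def)
      then show ?thesis using Mv[of i j] that by (simp add: min_absorb2)
    qed
    have X: "X \<in> int_mats val s t"
      using a by (auto simp: X_def int_mats_def intro!: divide_in_val_integers(1))
    have Y: "Y \<in> int_mats val r s"
      using b by (auto simp: Y_def int_mats_def intro!: divide_in_val_integers(1))
    have "M = DA * X + Y * DB"
    proof (rule eq_matI)
      fix i j assume "i < dim_row (DA * X + Y * DB)" "j < dim_col (DA * X + Y * DB)"
      then have ij: "i < r" "j < t" using DAc DBc int_matsD[OF X] int_matsD[OF Y] by auto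
      note e = entry[OF int_matsD(1)[OF X] int_matsD(1)[OF Y] ij]
      show "M $$ (i, j) = (DA * X + Y * DB) $$ (i, j)"
      proof (cases "?a i \<le> ?b j")
        case True
        have "(DA * X + Y * DB) $$ (i, j) = (if i < s then DA $$ (i, i) * (M $$ (i, j) / DA $$ (i, i)) else 0)"
          unfolding e using True ij by (simp add: X_def Y_def)
        also have "\<dots> = M $$ (i, j)"
        proof (cases "i < s")
          case i: True
          show ?thesis using divide_in_val_integers(2)[OF a[OF ij(1) i ij(2) True]] i by simp
        next
          case False
          \<comment> \<open>Here the product with \<open>DA\<close> contributes nothing; the
            infinite bound forces the entry of \<open>M\<close> to be 0 as well.\<close>
          then have "?a i = Pinf" using DAc by (simp add: diag_val_def)
          then have "M $$ (i, j) = 0" using True Mv[OF ij] by (simp add: val_eq_Pinf)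
          then show ?thesis using False by simp
        qed
        finally show ?thesis by simp
      next
        case False
        \<comment> \<open>In this case \<open>?b j\<close> is strictly below \<open>?a i\<close>,
          hence not infinite, so the diagonal entry of \<open>DB\<close> exists.\<close>
        have j: "j < s"
        proof (rule ccontr)
          assume "\<not> j < s"
          then have "?b j = Pinf" using DBc by (simp add: diag_val_def)
          then show False using False by simp
        qed
        have "(DA * X + Y * DB) $$ (i, j) = DB $$ (j, j) * (M $$ (i, j) / DB $$ (j, j))"
          unfolding e using False ij j by (simp add: X_def Y_def mult.commute)
        also have "\<dots> = M $$ (i, j)"
          using divide_in_val_integers(2)[OF b[OF ij(1) j ij(2) False]] .
        finally show ?thesis by simp
      qed
    qed (use int_matsD[OF Mi] DAc DBc int_matsD[OF Y] in simp_all)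
    then show "M \<in> ?L"
      using X Y by (intro image_eqI[of _ _ "(Y, X)"]) (simp_all add: mult_differential_def)
  qed
qed

text \<open>Multiplication by unimodular matrices permutes the integral pairs, so the inner factors
  \<open>VA\<close> and \<open>UB\<close> do not affect the image and only the outer
  \<open>UA\<close> and \<open>VB\<close> remain around the diagonal case.\<close>

lemma image_mult_differential:
  assumes A: "A \<in> int_mats val r s" "smith_decomposition val r s A UA DA VA"
    and B: "B \<in> int_mats val s t" "smith_decomposition val s t B UB DB VB"
  shows "mult_differential A B ` (int_mats val r s \<times> int_mats val s t)
    = (\<lambda>M. UA * M * VB) ` min_mats val r t (diag_val val DA) (diag_val val DB)"
proof -
  have D: "diagonal_mat DA" "diagonal_mat DB" and AB: "A = UA * DA * VA" "B = UB * DB * VB"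
    using A B by (auto simp: smith_decomposition_def)
  have DA: "DA \<in> int_mats val r s" using A by (rule smith_diagonal_integral)
  have DB: "DB \<in> int_mats val s t" using B by (rule smith_diagonal_integral)
  have GL: "UA \<in> int_GL val r" "VA \<in> int_GL val s" "UB \<in> int_GL val s" "VB \<in> int_GL val t"
    using A B by (auto simp: smith_decomposition_def)
  obtain UA' where UA: "UA \<in> int_mats val r r" "UA' \<in> int_mats val r r"
    "UA * UA' = 1\<^sub>m r" "UA' * UA = 1\<^sub>m r" using GL(1) by (rule int_GL_inverse)
  obtain VA' where VA: "VA \<in> int_mats val s s" "VA' \<in> int_mats val s s"
    "VA * VA' = 1\<^sub>m s" "VA' * VA = 1\<^sub>m s" using GL(2) by (rule int_GL_inverse)
  obtain UB' where UB: "UB \<in> int_mats val s s" "UB' \<in> int_mats val s s"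
    "UB * UB' = 1\<^sub>m s" "UB' * UB = 1\<^sub>m s" using GL(3) by (rule int_GL_inverse)
  obtain VB' where VB: "VB \<in> int_mats val t t" "VB' \<in> int_mats val t t"
    "VB * VB' = 1\<^sub>m t" "VB' * VB = 1\<^sub>m t" using GL(4) by (rule int_GL_inverse)
  let ?L0 = "int_mats val r s \<times> int_mats val s t"
  \<comment> \<open>This is the change of variables of \<open>mult_differential_conj\<close>. Since
    it maps \<open>?L0\<close> onto itself, it disappears once images are taken.\<close>
  let ?\<phi> = "\<lambda>(dA, dB). (UA' * dA * UB, VA * dB * VB')"
  have \<phi>: "?\<phi> ` ?L0 = ?L0"
  proof
    show "?\<phi> ` ?L0 \<subseteq> ?L0" using UA UB VA VB by (auto intro!: mult_in_int_mats)
    show "?L0 \<subseteq> ?\<phi> ` ?L0"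
    proof clarify
      fix P Q assume P: "P \<in> int_mats val r s" and Q: "Q \<in> int_mats val s t"
      have "UA' * (UA * P * UB') * UB = P"
        using P UA UB
        by (simp add: int_matsD assoc_mult_mat_dim mult_cancel_left_mat[of UA' UA r])
      moreover have "VA * (VA' * Q * VB) * VB' = Q"
        using Q VA VB
        by (simp add: int_matsD assoc_mult_mat_dim mult_cancel_left_mat[of VA VA' s])
      moreover have "UA * P * UB' \<in> int_mats val r s" "VA' * Q * VB \<in> int_mats val s t"
        using P Q UA UB VA VB by (auto intro!: mult_in_int_mats)
      ultimately show "(P, Q) \<in> ?\<phi> ` ?L0"
        by (intro image_eqI[of _ _ "(UA * P * UB', VA' * Q * VB)"]) auto
    qed
  qed
  have conj: "mult_differential A B p = UA * mult_differential DA DB (?\<phi> p) * VB"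
    if mem: "p \<in> ?L0" for p
  proof -
    obtain dA dB where p: "p = (dA, dB)" "dA \<in> int_mats val r s" "dB \<in> int_mats val s t"
      using mem by auto
    show ?thesis
      unfolding p(1) AB prod.case
      using mult_differential_conj[OF int_matsD(1)[OF UA(1)] int_matsD(1)[OF UA(2)]
          int_matsD(1)[OF VA(1)] int_matsD(1)[OF UB(1)] int_matsD(1)[OF VB(1)] int_matsD(1)[OF VB(2)]
          int_matsD(1)[OF DA] int_matsD(1)[OF DB] int_matsD(1)[OF p(2)] int_matsD(1)[OF p(3)] UA(3) VB(4)] .
  qed
  have "mult_differential A B ` ?L0 = (\<lambda>p. UA * mult_differential DA DB (?\<phi> p) * VB) ` ?L0"
    by (intro image_cong refl conj)
  also have "\<dots> = (\<lambda>M. UA * M * VB) ` mult_differential DA DB ` ?\<phi> ` ?L0"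
    by (simp only: image_image)
  also have "\<dots> = (\<lambda>M. UA * M * VB) ` mult_differential DA DB ` ?L0"
    by (simp only: \<phi>)
  also have "\<dots> = (\<lambda>M. UA * M * VB) ` min_mats val r t (diag_val val DA) (diag_val val DB)"
    by (simp only: mult_differential_diagonal[OF DA D(1) DB D(2)])
  finally show ?thesis .
qed

text \<open>The map \<open>M \<mapsto> U * M * V\<close> is an automorphism of the module of
  integral matrices, with inverse given by \<open>U'\<close> and \<open>V'\<close>, so
  \<open>module_length_quot_iso\<close> applies.\<close>

lemma module_length_quot_conj:
  assumes U: "U \<in> int_GL val r" and V: "V \<in> int_GL val t"
    and N: "submodule N (val_ring val) (int_mat_module val r t)"
  shows "module_length (val_ring val) (quot_module (int_mat_module val r t) ((\<lambda>M. U * M * V) ` N))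
    = module_length (val_ring val) (quot_module (int_mat_module val r t) N)"
proof -
  obtain U' where U: "U \<in> int_mats val r r" "U' \<in> int_mats val r r"
    "U * U' = 1\<^sub>m r" "U' * U = 1\<^sub>m r" using U by (rule int_GL_inverse)
  obtain V' where V: "V \<in> int_mats val t t" "V' \<in> int_mats val t t"
    "V * V' = 1\<^sub>m t" "V' * V = 1\<^sub>m t" using V by (rule int_GL_inverse)
  note dims = int_matsD(1-3)[OF U(1)] int_matsD(1-3)[OF U(2)] int_matsD(1-3)[OF V(1)]
    int_matsD(1-3)[OF V(2)]
  have add: "P * (X + Y) * Q = P * X * Q + P * Y * Q"
    if "P \<in> int_mats val r r" "Q \<in> int_mats val t t" "X \<in> int_mats val r t" "Y \<in> int_mats val r t"
    for P Q X Y
    using that by (simp add: int_matsD mult_add_distrib_mat_dim add_mult_distrib_mat_dim)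
  have smult: "P * (a \<cdot>\<^sub>m X) * Q = a \<cdot>\<^sub>m (P * X * Q)"
    if "P \<in> int_mats val r r" "Q \<in> int_mats val t t" "X \<in> int_mats val r t" for P Q X a
    using int_matsD(1)[OF that(1)] int_matsD(1)[OF that(2)] int_matsD(1)[OF that(3)]
    by (metis mult_carrier_mat mult_smult_assoc_mat mult_smult_distrib)
  show ?thesis
  proof (rule module.module_length_quot_iso[OF module_int_mat N, where g = "\<lambda>M. U' * M * V'"];
      unfold int_mat_module_simps)
    fix X assume X: "X \<in> int_mats val r t"
    show "U * X * V \<in> int_mats val r t" "U' * X * V' \<in> int_mats val r t"
      using X U V by (auto intro!: mult_in_int_mats)
    show "U' * (U * X * V) * V' = X"
      using X U V dims by (simp add: int_matsD assoc_mult_mat_dim mult_cancel_left_mat[of U' U r])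
    show "U * (U' * X * V') * V = X"
      using X U V dims by (simp add: int_matsD assoc_mult_mat_dim mult_cancel_left_mat[of U U' r])
  qed (use U V add smult in auto)
qed

end

theorem proposition3p1:
  fixes val :: "'k::field \<Rightarrow> int extended"
    and r s t :: nat
    and A B UA DA VA UB DB VB :: "'k mat"
  assumes "complete_discrete_valuation val"
    and "0 < r" and "0 < s" and "0 < t"
    and "A \<in> int_mats val r s"
    and "B \<in> int_mats val s t"
    and "smith_decomposition val r s A UA DA VA"
    and "smith_decomposition val s t B UB DB VB"
  shows "mult_differential A B ` (int_mats val r s \<times> int_mats val s t)
           = {UA * M * VB | M. M \<in> min_mats val r t (diag_val val DA) (diag_val val DB)} \<and>
         extended_of_enat
           (module_length (val_ring val)
             (quot_module (int_mat_module val r t)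
               (mult_differential A B ` (int_mats val r s \<times> int_mats val s t))))
           = (\<Sum>i<r. \<Sum>j<t. min (diag_val val DA i) (diag_val val DB j))"
proof -
  interpret complete_discrete_valuation val by fact
  let ?c = "\<lambda>i j. min (diag_val val DA i) (diag_val val DB j)"
  have image: "mult_differential A B ` (int_mats val r s \<times> int_mats val s t)
      = (\<lambda>M. UA * M * VB) ` min_mats val r t (diag_val val DA) (diag_val val DB)"
    using assms by (intro image_mult_differential)
  \<comment> \<open>Integrality of the diagonal factors makes the bounds \<open>?c i j\<close>
    nonnegative, as the length formula requires.\<close>
  have "DA \<in> int_mats val r s" "DB \<in> int_mats val s t"
    using assms by (auto intro: smith_diagonal_integral)
  then have "extended_of_enat (module_length (val_ring val)
      (quot_module (int_mat_module val r t) (val_mats val r t ?c))) = (\<Sum>i<r. \<Sum>j<t. ?c i j)"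
    by (intro module_length_quot_val_mats) (simp add: diag_val_nonneg)
  moreover have "UA \<in> int_GL val r" "VB \<in> int_GL val t"
    using assms by (auto simp: smith_decomposition_def)
  ultimately show ?thesis
    \<comment> \<open>The image is now a two-sided unimodular translate of a \<open>val_mats\<close>
      submodule, and the translation does not change the length of the quotient.\<close>
    unfolding image min_mats_eq_val_mats
    by (simp add: module_length_quot_conj submodule_val_mats Setcompr_eq_image)
qed

end
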